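(* Let $M_8$ be the Turing machine with the 13 states $A,B,C,D,E,F,G,H,I,J,K,L,M$ (plus halting state $Z$) and the two symbols $0,1$ (where $0$ is the blank symbol) defined in the context. The $3x+1$ conjecture is true if and only if, for every positive integer $n=\sum_{i=0}^k x_i2^i$, written in binary as $x_k\ldots x_0$, the Turing machine $M_8$ halts on the initial configuration ${}^\omega 0(A1)x_01x_1\ldots 1x_k0^\omega$.
   Context: The $3x+1$ function $T$ on positive integers is $T(m)=m/2$ if $m$ is even and $T(m)=(3m+1)/2$ if $m$ is odd. The $3x+1$ conjecture is the assertion that, when $T$ is iterated from any positive integer, the loop $2\mapsto 1\mapsto 2$ is always reached (i.e. for every positive integer $m$ some iterate $T^j(m)$, $j\ge 0$, lies in $\{1,2\}$; equivalently some iterate equals $1$). Turing machines have one tape, infinite on both sides, made of cells containing symbols, one read/write head, a set $Q$ of states plus a halting state $Z$, a set $\Sigma$ of symbols containing a blank symbol (here $\Sigma=\{0,1\}$ with blank $0$), and a next move function $\delta$. If $\delta(p,a)=(a',\Delta,q)$ then the machine, reading symbol $a$ in state $p$, replaces $a$ by $a'$, moves one cell in direction $\Delta$, where $\Delta$ is left or right, and enters state $q$. The machine halts when it enters state $Z$ (here $H$ is an ordinary, non-halting state). Binary representations are the usual ones, with $x_i\in\{0,1\}$ and $x_k=1$. The number is put on the tape with the least significant bit at the left end, digits $0$ and $1$ being coded by the two-symbol words $10$ and $11$: the configuration ${}^\omega 0(A1)x_01x_1\ldots 1x_k0^\omega$ is the one in which the word $1x_01x_1\ldots 1x_k$ of length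 $2(k+1)$ is written on the tape between two infinite strings of $0$s, the machine is in state $A$, and the head is on the leftmost symbol $1$ of this word. The machine $M_8$ has the following transitions, where a triple $(a',\Delta,q)$ means: write $a'$, move in direction $\Delta$ ("left" or "right"), enter state $q$; the pair (state $I$, symbol $1$), not listed, has no transition defined (and reaching it does not count as halting): State $A$: on $0$: $(1,\text{right},I)$; on $1$: $(0,\text{right},L)$. State $B$: on $0$: $(0,\text{right},A)$; on $1$: $(0,\text{right},G)$. State $C$: on $0$: $(0,\text{right},A)$; on $1$: $(1,\text{right},D)$. State $D$: on $0$: $(0,\text{right},C)$; on $1$: $(1,\text{right},E)$. State $E$: on $0$: $(1,\text{right},I)$; on $1$: $(1,\text{right},F)$. State $F$: on $0$: $(1,\text{right},C)$; on $1$: $(0,\text{right},G)$. State $G$: on $0$: $(1,\text{right},C)$; on $1$: $(1,\text{right},H)$. State $H$: on $0$: $(0,\text{right},E)$; on $1$: $(1,\text{right},G)$. State $I$: on $0$: $(1,\text{left},J)$. State $J$: on $0$: $(0,\text{right},B)$; on $1$: $(1,\text{left},K)$. State $K$: on $0$: $(0,\text{left},J)$; on $1$: $(1,\text{left},J)$. State $L$: on $0$: $(0,\text{right},A)$; on $1$: $(0,\text{right},M)$. State $M$: on $0$: $(0,\text{left},Z)$; on $1$: $(1,\text{right},H)$. *)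

theory Defs
  imports Main
begin

definition collatz_T :: "nat \<Rightarrow> nat" where
  "collatz_T m = (if even m then m div 2 else (3 * m + 1) div 2)"

definition collatz_conjecture :: bool where
  "collatz_conjecture \<longleftrightarrow> (\<forall>m>0. \<exists>j. (collatz_T ^^ j) m \<in> {1, 2})"

datatype direction = Left | Right

fun move :: "direction \<Rightarrow> int \<Rightarrow> int" where
  "move Left h = h - 1"
| "move Right h = h + 1"

text \<open>A next move function is partial: \<open>None\<close> means that no transition is defined.\<close>

type_synonym ('q, 's) next_move = "'q \<Rightarrow> 's \<Rightarrow> ('s \<times> direction \<times> 'q) option"

text \<open>A configuration consists of the state, the tape (infinite on both sides)
  and the position of the head.\<close>

datatype ('q, 's) config = Config 'q "int \<Rightarrow> 's" int

inductive tm_step :: "('q, 's) next_move \<Rightarrow> ('q, 's) config \<Rightarrow> ('q, 's) config \<Rightarrow> bool"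
  for \<delta> where
  "\<delta> p (t h) = Some (a', d, q) \<Longrightarrow>
     tm_step \<delta> (Config p t h) (Config q (t(h := a')) (move d h))"

text \<open>Halting means entering the halting state \<open>z\<close>; getting stuck in another state,
  for lack of a transition, is not halting.\<close>

definition tm_halts :: "('q, 's) next_move \<Rightarrow> 'q \<Rightarrow> ('q, 's) config \<Rightarrow> bool" where
  "tm_halts \<delta> z c \<longleftrightarrow> (\<exists>t h. (tm_step \<delta>)\<^sup>*\<^sup>* c (Config z t h))"

definition word_tape :: "'s \<Rightarrow> 's list \<Rightarrow> int \<Rightarrow> 's" where
  "word_tape blank w i = (if 0 \<le> i \<and> i < int (length w) then w ! nat i else blank)"

datatype symbol = S0 | S1

datatype m8_state = QA | QB | QC | QD | QE | QF | QG | QH | QI | QJ | QK | QL | QM | QZ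

fun M8 :: "(m8_state, symbol) next_move" where
  "M8 QA S0 = Some (S1, Right, QI)"
| "M8 QA S1 = Some (S0, Right, QL)"
| "M8 QB S0 = Some (S0, Right, QA)"
| "M8 QB S1 = Some (S0, Right, QG)"
| "M8 QC S0 = Some (S0, Right, QA)"
| "M8 QC S1 = Some (S1, Right, QD)"
| "M8 QD S0 = Some (S0, Right, QC)"
| "M8 QD S1 = Some (S1, Right, QE)"
| "M8 QE S0 = Some (S1, Right, QI)"
| "M8 QE S1 = Some (S1, Right, QF)"
| "M8 QF S0 = Some (S1, Right, QC)"
| "M8 QF S1 = Some (S0, Right, QG)"
| "M8 QG S0 = Some (S1, Right, QC)"
| "M8 QG S1 = Some (S1, Right, QH)"
| "M8 QH S0 = Some (S0, Right, QE)"
| "M8 QH S1 = Some (S1, Right, QG)"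
| "M8 QI S0 = Some (S1, Left, QJ)"
| "M8 QI S1 = None"
| "M8 QJ S0 = Some (S0, Right, QB)"
| "M8 QJ S1 = Some (S1, Left, QK)"
| "M8 QK S0 = Some (S0, Left, QJ)"
| "M8 QK S1 = Some (S1, Left, QJ)"
| "M8 QL S0 = Some (S0, Right, QA)"
| "M8 QL S1 = Some (S0, Right, QM)"
| "M8 QM S0 = Some (S0, Left, QZ)"
| "M8 QM S1 = Some (S1, Right, QH)"
| "M8 QZ _ = None"

definition digit_symbol :: "nat \<Rightarrow> symbol" where
  "digit_symbol d = (if d = 0 then S0 else S1)"

text \<open>The word \<open>1 x\<^sub>0 1 x\<^sub>1 \<dots> 1 x\<^sub>k\<close>: each binary digit is preceded by \<open>1\<close>,
  least significant digit first.\<close>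

definition m8_word :: "(nat \<Rightarrow> nat) \<Rightarrow> nat \<Rightarrow> symbol list" where
  "m8_word x k = concat (map (\<lambda>i. [S1, digit_symbol (x i)]) [0..<Suc k])"

definition m8_initial :: "(nat \<Rightarrow> nat) \<Rightarrow> nat \<Rightarrow> (m8_state, symbol) config" where
  "m8_initial x k = Config QA (word_tape S0 (m8_word x k)) 0"

end

theory Submission
  imports Defs
begin

text \<open>
  Started in state \<open>A\<close> on the encoding of \<open>n\<close>, the machine carries out the map \<open>T\<close> over and over,
  and it halts exactly when the number on the tape is \<open>1\<close>. Each digit occupies a pair of cells
  \<open>1 x\<close>, so that the blank cell found where a leading \<open>1\<close> is expected marks the end of the number.

  If \<open>n\<close> is even, state \<open>A\<close> just erases the lowest pair and ends up two cells further to the right,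
  on the encoding of \<open>n div 2\<close>. If \<open>n = 2 * m + 1\<close>, then \<open>T n = 3 * m + 2\<close>. The lowest pair is
  erased again, and what follows encodes \<open>m\<close>. If \<open>m = 0\<close>, this is blank and the machine halts.
  Otherwise the machine multiplies \<open>m\<close> by \<open>3\<close> by the school method, from the lowest digit upwards,
  with initial carry \<open>2\<close>: the states \<open>C\<close>, \<open>E\<close>, \<open>G\<close> stand for the carries \<open>0\<close>, \<open>1\<close>, \<open>2\<close> in front of a
  pair, and \<open>D\<close>, \<open>F\<close>, \<open>H\<close> for the same carries inside a pair. At the end of the number the carry is
  written out, and the states \<open>J\<close>, \<open>K\<close> bring the head back to the low end. This is the content of
  \<open>multiply_by_3\<close>, and \<open>simulate_collatz_T\<close> combines both parities.

  If the orbit of \<open>n\<close> contains \<open>1\<close>, the machine therefore halts. Conversely, the machine is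
  deterministic and each application of \<open>T\<close> costs at least one step, so a halting run passes only
  finitely many encodings, and the last of them must be an encoding of \<open>1\<close>. Finally, an orbit meets
  \<open>{1, 2}\<close> if and only if it contains \<open>1\<close>, because \<open>T 2 = 1\<close>.
\<close>


section \<open>Deterministic runs\<close>

lemma tm_step_deterministic:
  "tm_step \<delta> c d \<Longrightarrow> tm_step \<delta> c e \<Longrightarrow> d = e"
  by (auto elim!: tm_step.cases)

text \<open>With a literal number of steps, the simplifier executes the machine symbolically on a tape
  of which only the cells that are read need to be known.\<close>

fun run_for :: "('q, 's) next_move \<Rightarrow> nat \<Rightarrow> ('q, 's) config \<Rightarrow> ('q, 's) config option" where
  "run_for \<delta> 0 c = Some c"
| "run_for \<delta> (Suc n) (Config q t h) = (case \<delta> q (t h) of None \<Rightarrow> None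
    | Some (a, d, q') \<Rightarrow> run_for \<delta> n (Config q' (t(h := a)) (move d h)))"

lemma run_for_numeral [simp]:
  "run_for \<delta> (numeral k) (Config q t h) = (case \<delta> q (t h) of None \<Rightarrow> None
    | Some (a, d, q') \<Rightarrow> run_for \<delta> (pred_numeral k) (Config q' (t(h := a)) (move d h)))"
  by (simp only: numeral_eq_Suc run_for.simps)

lemma run_for_reachable:
  "run_for \<delta> n c = Some e \<Longrightarrow> (tm_step \<delta>)\<^sup>*\<^sup>* c e"
  by (induction \<delta> n c rule: run_for.induct)
    (auto split: option.splits intro: converse_rtranclp_into_rtranclp tm_step.intros)

lemma run_continues_after_step:
  assumes "tm_step \<delta> c d" "(tm_step \<delta>)\<^sup>*\<^sup>* c e" "c \<noteq> e"
  shows "(tm_step \<delta>)\<^sup>*\<^sup>* d e"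
  using assms by (metis converse_rtranclpE tm_step_deterministic)

text \<open>A run that ends in a stuck configuration passes through everything that can be reached, so
  a prefix of positive length can be cut off from it. This gives the measure for induction along
  a halting run.\<close>

lemma stuck_run_shorter_after_prefix:
  assumes "(tm_step \<delta> ^^ N) c e" and stuck: "\<And>d. \<not> tm_step \<delta> e d"
    and "(tm_step \<delta>)\<^sup>+\<^sup>+ c c'"
  shows "\<exists>M<N. (tm_step \<delta> ^^ M) c' e"
proof -
  have drop_step: "\<exists>M'<M. (tm_step \<delta> ^^ M') b e"
    if run: "(tm_step \<delta> ^^ M) a e" and ab: "tm_step \<delta> a b" for M a b
  proof (cases M)
    case 0
    then show ?thesis using run ab stuck by auto
  next
    case (Suc M')
    then obtain b' where "tm_step \<delta> a b'" "(tm_step \<delta> ^^ M') b' e"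
      using run relpowp_Suc_D2 by metis
    then show ?thesis using ab Suc tm_step_deterministic by blast
  qed
  show ?thesis
    using assms(3)
  proof (induction rule: tranclp_induct)
    case (base c')
    then show ?case using assms(1) drop_step by blast
  next
    case (step d c')
    then show ?case using drop_step less_trans by blast
  qed
qed


section \<open>Numbers on the tape\<close>

text \<open>Only the cells from \<open>p\<close> on matter here. The low end of the number is at \<open>p\<close>, so that both
  dropping the lowest digit and passing it with the head move \<open>p\<close> by two cells.\<close>

inductive encodes :: "(int \<Rightarrow> symbol) \<Rightarrow> int \<Rightarrow> nat \<Rightarrow> bool" for t where
  zero: "(\<And>h. p \<le> h \<Longrightarrow> t h = S0) \<Longrightarrow> encodes t p 0"
| digit: "t p = S1 \<Longrightarrow> t (p + 1) = digit_symbol (m mod 2) \<Longrightarrow> encodes t (p + 2) (m div 2)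
    \<Longrightarrow> m > 0 \<Longrightarrow> encodes t p m"

lemma encodes_cong:
  assumes "encodes t p m" "\<And>h. p \<le> h \<Longrightarrow> t' h = t h"
  shows "encodes t' p m"
  using assms by induction (auto intro: encodes.intros)

lemma encodes_0D: "encodes t p 0 \<Longrightarrow> p \<le> h \<Longrightarrow> t h = S0"
  by (auto elim: encodes.cases)

lemma encodes_posD:
  assumes "encodes t p m" "m > 0"
  shows "t p = S1" "t (p + 1) = digit_symbol (m mod 2)" "encodes t (p + 2) (m div 2)"
  using assms by (auto elim: encodes.cases)


section \<open>Multiplication by three\<close>

definition carry_state :: "nat \<Rightarrow> m8_state" where
  "carry_state c = (if c = 0 then QC else if c = 1 then QE else QG)"

lemma multiply_digit:
  assumes "t p = S1" "t (p + 1) = digit_symbol d" "d < 2" "c < 3"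
  shows "(tm_step M8)\<^sup>*\<^sup>* (Config (carry_state c) t p)
    (Config (carry_state ((3 * d + c) div 2))
      (t(p + 1 := digit_symbol ((3 * d + c) mod 2))) (p + 2))"
proof (rule run_for_reachable[of _ 2])
  have "d = 0 \<or> d = 1" "c = 0 \<or> c = 1 \<or> c = 2" using assms(3,4) by auto
  then show "run_for M8 2 (Config (carry_state c) t p) = Some (Config (carry_state ((3 * d + c) div 2))
      (t(p + 1 := digit_symbol ((3 * d + c) mod 2))) (p + 2))"
    using assms(1,2)
    by (elim disjE) (auto simp: carry_state_def digit_symbol_def fun_eq_iff)
qed

lemma sweep_left:
  assumes "t p = S1"
  shows "(tm_step M8)\<^sup>*\<^sup>* (Config QJ t p) (Config QJ t (p - 2))"
  using assms
  by (intro run_for_reachable[of _ 2], cases "t (p - 1)") (auto simp: fun_eq_iff)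

text \<open>At the end of the number the carry is written out as one or two new digits. A carry \<open>0\<close>
  does not get there: the topmost digit of \<open>m\<close> is \<open>1\<close>, and \<open>3 * 1 + c\<close> leaves the positive carry
  \<open>(3 + c) div 2\<close>. For this reason the case \<open>m = 0\<close> comes with \<open>c > 0\<close>. The way back is part of the
  induction: each pair that is passed on the way up is passed once more on the way down.\<close>

lemma multiply_by_3:
  assumes "encodes t p m" "c < 3" "m > 0 \<or> c > 0"
  shows "\<exists>t'. (tm_step M8)\<^sup>*\<^sup>* (Config (carry_state c) t p) (Config QJ t' (p - 2))
    \<and> encodes t' p (3 * m + c) \<and> (\<forall>h<p. t' h = t h)"
  using assms
proof (induction m arbitrary: p c t rule: less_induct)
  case (less m)
  show ?case
  proof (cases "m = 0")
    case True
    have blank: "t h = S0" if "p \<le> h" for h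
      using less.prems(1) that True encodes_0D by blast
    have "c = 1 \<or> c = 2" using less.prems(2,3) True by auto
    then show ?thesis
    proof
      assume c: "c = 1"
      let ?t = "t(p := S1, p + 1 := S1)"
      have top: "(tm_step M8)\<^sup>*\<^sup>* (Config QE t p) (Config QJ ?t p)"
        by (rule run_for_reachable[of _ 2]) (auto simp: blank fun_eq_iff)
      have "(tm_step M8)\<^sup>*\<^sup>* (Config (carry_state c) t p) (Config QJ ?t (p - 2))"
        using rtranclp_trans[OF top sweep_left] by (simp add: c carry_state_def)
      moreover have "encodes ?t p 1"
        by (rule encodes.digit) (auto simp: digit_symbol_def blank intro!: encodes.zero)
      then have "encodes ?t p (3 * m + c)" by (simp add: True c)
      moreover have "\<forall>h<p. ?t h = t h" by simp
      ultimately show ?thesis by - (intro exI[of _ ?t] conjI)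
    next
      assume c: "c = 2"
      let ?t = "t(p := S1, p + 1 := S0, p + 2 := S1, p + 3 := S1)"
      have top: "(tm_step M8)\<^sup>*\<^sup>* (Config QG t p) (Config QJ ?t (p + 2))"
        by (rule run_for_reachable[of _ 4]) (auto simp: blank fun_eq_iff)
      have sweep: "(tm_step M8)\<^sup>*\<^sup>* (Config QJ ?t (p + 2)) (Config QJ ?t p)"
        using sweep_left[of ?t "p + 2"] by simp
      have "(tm_step M8)\<^sup>*\<^sup>* (Config (carry_state c) t p) (Config QJ ?t (p - 2))"
        using rtranclp_trans[OF top rtranclp_trans[OF sweep sweep_left]]
        by (simp add: c carry_state_def)
      moreover have "encodes ?t (p + 2) 1"
        by (rule encodes.digit) (auto simp: digit_symbol_def blank intro!: encodes.zero)
      then have "encodes ?t p 2"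
        by (intro encodes.digit[of _ p 2]) (auto simp: digit_symbol_def)
      then have "encodes ?t p (3 * m + c)" by (simp add: True c numeral_2_eq_2)
      moreover have "\<forall>h<p. ?t h = t h" by simp
      ultimately show ?thesis by - (intro exI[of _ ?t] conjI)
    qed
  next
    case False
    define c' where "c' = (3 * (m mod 2) + c) div 2"
    define t1 where "t1 = t(p + 1 := digit_symbol ((3 * (m mod 2) + c) mod 2))"
    note enc = encodes_posD[OF less.prems(1)]
    have up: "(tm_step M8)\<^sup>*\<^sup>* (Config (carry_state c) t p) (Config (carry_state c') t1 (p + 2))"
      unfolding c'_def t1_def using False enc less.prems(2) by (intro multiply_digit) auto
    have "c' < 3" using less.prems(2) by (auto simp: c'_def)
    moreover have "m div 2 > 0 \<or> c' > 0"
      using False by (cases "m = 1") (auto simp: c'_def)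
    moreover have "encodes t1 (p + 2) (m div 2)"
      by (rule encodes_cong[OF enc(3)]) (use False in \<open>auto simp: t1_def\<close>)
    ultimately obtain t2 where
      rec: "(tm_step M8)\<^sup>*\<^sup>* (Config (carry_state c') t1 (p + 2)) (Config QJ t2 p)"
        "encodes t2 (p + 2) (3 * (m div 2) + c')" "\<forall>h<p+2. t2 h = t1 h"
      using less.IH[of "m div 2" t1 "p + 2" c'] False by auto
    have "t2 p = S1" using rec(3) enc(1) False by (simp add: t1_def)
    have "(tm_step M8)\<^sup>*\<^sup>* (Config (carry_state c) t p) (Config QJ t2 (p - 2))"
      by (rule rtranclp_trans[OF up rtranclp_trans[OF rec(1) sweep_left[of t2 p]]]) fact
    moreover have "encodes t2 p (3 * m + c)"
    proof (rule encodes.digit)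
      have m: "3 * m + c = 2 * (3 * (m div 2)) + (3 * (m mod 2) + c)"
        by presburger
      have "(3 * m + c) mod 2 = (3 * (m mod 2) + c) mod 2"
        by (subst m) (rule mod_mult_self4)
      then show "t2 (p + 1) = digit_symbol ((3 * m + c) mod 2)"
        using rec(3) by (simp add: t1_def)
      have "(3 * m + c) div 2 = 3 * (m div 2) + c'"
        unfolding c'_def by (subst m) (rule div_mult_self4, simp)
      then show "encodes t2 (p + 2) ((3 * m + c) div 2)" using rec(2) by simp
    qed (use \<open>t2 p = S1\<close> False in auto)
    moreover have "\<forall>h<p. t2 h = t h" using rec(3) by (simp add: t1_def)
    ultimately show ?thesis by - (intro exI[of _ t2] conjI)
  qed
qed


section \<open>One application of the Collatz map\<close>

text \<open>The blanks to the left are part of this because the way back after a multiplication is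
  stopped by the blank pair just below the number.\<close>

definition ready :: "nat \<Rightarrow> (m8_state, symbol) config \<Rightarrow> bool" where
  "ready n c \<longleftrightarrow> (\<exists>t p. c = Config QA t p \<and> encodes t p n \<and> (\<forall>h<p. t h = S0))"

lemma halts_on_1:
  assumes "ready 1 c"
  shows "tm_halts M8 QZ c"
proof -
  obtain t p where c: "c = Config QA t p" and enc: "encodes t p 1"
    using assms by (auto simp: ready_def)
  note enc1 = encodes_posD[OF enc]
  have "t p = S1" "t (p + 1) = S1" "t (p + 2) = S0"
    using enc1 encodes_0D[of t "p + 2" "p + 2"] by (auto simp: digit_symbol_def)
  then have "(tm_step M8)\<^sup>*\<^sup>* c (Config QZ (t(p := S0, p + 1 := S0, p + 2 := S0)) (p + 1))"
    unfolding c by (intro run_for_reachable[of _ 3]) (auto simp: add.commute fun_eq_iff)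
  then show ?thesis by (auto simp: tm_halts_def)
qed

text \<open>For odd \<open>n\<close> the multiplication is entered through state \<open>M\<close> instead of \<open>G\<close>, as \<open>M\<close> is what
  recognises \<open>n = 1\<close>. On the symbol \<open>1\<close> the two states act alike, and determinism allows the
  first step of the run given by \<open>multiply_by_3\<close> to be replaced by the step from \<open>M\<close>.\<close>

lemma simulate_collatz_T:
  assumes "ready n c" "n > 1"
  shows "\<exists>c'. ready (collatz_T n) c' \<and> (tm_step M8)\<^sup>+\<^sup>+ c c'"
proof -
  obtain t p where c: "c = Config QA t p" and enc: "encodes t p n" and left: "\<forall>h<p. t h = S0"
    using assms(1) by (auto simp: ready_def)
  note enc1 = encodes_posD[OF enc]
  then have sym: "t p = S1" "t (p + 1) = (if even n then S0 else S1)"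
    using assms(2) by (auto simp: digit_symbol_def even_iff_mod_2_eq_zero)
  define t1 where "t1 = t(p := S0, p + 1 := S0)"
  have enc2: "encodes t1 (p + 2) (n div 2)"
    by (rule encodes_cong[OF enc1(3)]) (use assms(2) in \<open>auto simp: t1_def\<close>)
  have left1: "t1 h = S0" if "h < p + 2" for h
    using that left by (cases "h = p \<or> h = p + 1") (auto simp: t1_def)
  have "\<exists>t'. ready (collatz_T n) (Config QA t' (p + 2))
    \<and> (tm_step M8)\<^sup>*\<^sup>* c (Config QA t' (p + 2))"
  proof (cases "even n")
    case True
    have "(tm_step M8)\<^sup>*\<^sup>* c (Config QA t1 (p + 2))"
      unfolding c t1_def using sym True
      by (intro run_for_reachable[of _ 2]) (auto simp: fun_eq_iff)
    then show ?thesis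
      using True enc2 left1 by (auto simp: ready_def collatz_T_def)
  next
    case False
    define m where "m = n div 2"
    have m: "n = 2 * m + 1" "m > 0" using False assms(2) by (auto simp: m_def)
    have sep: "t1 (p + 2) = S1" using encodes_posD(1)[OF enc2[folded m_def] m(2)] .
    have to_M: "(tm_step M8)\<^sup>*\<^sup>* c (Config QM t1 (p + 2))"
      unfolding c t1_def using sym False
      by (intro run_for_reachable[of _ 2]) (auto simp: fun_eq_iff)
    have M_to_H: "(tm_step M8)\<^sup>*\<^sup>* (Config QM t1 (p + 2)) (Config QH t1 (p + 3))"
      using sep by (intro run_for_reachable[of _ 1]) (auto simp: fun_eq_iff)
    obtain t2 where mult: "(tm_step M8)\<^sup>*\<^sup>* (Config QG t1 (p + 2)) (Config QJ t2 p)"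
      and enc3: "encodes t2 (p + 2) (3 * m + 2)" and left2: "\<forall>h<p+2. t2 h = t1 h"
      using multiply_by_3[OF enc2[folded m_def], of 2] by (auto simp: carry_state_def)
    have "tm_step M8 (Config QG t1 (p + 2)) (Config QH t1 (p + 3))"
      using tm_step.intros[of M8 QG t1 "p + 2"] sep by (simp add: fun_upd_idem add.commute)
    then have H_to_J: "(tm_step M8)\<^sup>*\<^sup>* (Config QH t1 (p + 3)) (Config QJ t2 p)"
      using mult by (rule run_continues_after_step) simp
    \<comment> \<open>The erased lowest pair at \<open>p\<close> and \<open>p + 1\<close> turns the head around.\<close>
    have J_to_A: "(tm_step M8)\<^sup>*\<^sup>* (Config QJ t2 p) (Config QA t2 (p + 2))"
    proof -
      have "t2 p = S0" "t2 (p + 1) = S0" using left1 left2 by auto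
      then show ?thesis
        by (intro run_for_reachable[of _ 2]) (auto simp: fun_eq_iff)
    qed
    have "(tm_step M8)\<^sup>*\<^sup>* c (Config QA t2 (p + 2))"
      using to_M M_to_H H_to_J J_to_A by (rule rtranclp_trans[OF rtranclp_trans[OF rtranclp_trans]])
    moreover have "collatz_T n = 3 * m + 2" by (simp add: collatz_T_def m(1))
    ultimately show ?thesis using enc3 left1 left2 by (auto simp: ready_def)
  qed
  then obtain t' where t': "ready (collatz_T n) (Config QA t' (p + 2))"
    "(tm_step M8)\<^sup>*\<^sup>* c (Config QA t' (p + 2))" by blast
  \<comment> \<open>For both parities the head is now two cells further to the right, so some step was made.\<close>
  have "c \<noteq> Config QA t' (p + 2)" by (simp add: c)
  with t' show ?thesis by (meson rtranclpD)
qed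


section \<open>Halting and the orbit\<close>

lemma halts_iff_orbit_contains_1:
  assumes "ready n c" "n > 0"
  shows "tm_halts M8 QZ c \<longleftrightarrow> (\<exists>j. (collatz_T ^^ j) n = 1)"
proof
  assume "\<exists>j. (collatz_T ^^ j) n = 1"
  then obtain j where "(collatz_T ^^ j) n = 1" ..
  then show "tm_halts M8 QZ c"
    using assms
  proof (induction j arbitrary: n c)
    case 0
    then show ?case by (simp add: halts_on_1)
  next
    case (Suc j)
    show ?case
    proof (cases "n = 1")
      case True
      then show ?thesis using Suc.prems halts_on_1 by blast
    next
      case False
      then obtain c' where c': "ready (collatz_T n) c'" "(tm_step M8)\<^sup>+\<^sup>+ c c'"
        using simulate_collatz_T[of n c] Suc.prems by auto
      have "collatz_T n > 0" using Suc.prems(3) False by (auto simp: collatz_T_def elim!: evenE)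
      then have "tm_halts M8 QZ c'"
        using Suc.IH Suc.prems(1) c'(1) by (simp add: funpow_swap1)
      then show ?thesis
        using c'(2) by (meson rtranclp_trans tm_halts_def tranclp_into_rtranclp)
    qed
  qed
next
  assume "tm_halts M8 QZ c"
  then obtain t h N where "(tm_step M8 ^^ N) c (Config QZ t h)"
    by (auto simp: tm_halts_def rtranclp_power)
  then show "\<exists>j. (collatz_T ^^ j) n = 1"
    using assms
  proof (induction N arbitrary: n c rule: less_induct)
    case (less N)
    show ?case
    proof (cases "n = 1")
      case True
      then have "(collatz_T ^^ 0) n = 1" by simp
      then show ?thesis ..
    next
      case False
      then obtain c' where c': "ready (collatz_T n) c'" "(tm_step M8)\<^sup>+\<^sup>+ c c'"
        using simulate_collatz_T[of n c] less.prems by auto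
      have "collatz_T n > 0" using less.prems(3) False by (auto simp: collatz_T_def elim!: evenE)
      moreover have "\<exists>M<N. (tm_step M8 ^^ M) c' (Config QZ t h)"
        by (rule stuck_run_shorter_after_prefix[OF less.prems(1) _ c'(2)])
          (auto elim: tm_step.cases)
      ultimately obtain j where "(collatz_T ^^ j) (collatz_T n) = 1"
        using less.IH c'(1) by blast
      then have "(collatz_T ^^ Suc j) n = 1" by (simp add: funpow_swap1)
      then show ?thesis ..
    qed
  qed
qed

lemma orbit_meets_cycle_iff_contains_1:
  "(\<exists>j. (collatz_T ^^ j) m \<in> {1, 2}) \<longleftrightarrow> (\<exists>j. (collatz_T ^^ j) m = 1)"
proof
  assume "\<exists>j. (collatz_T ^^ j) m \<in> {1, 2}"
  then obtain j where "(collatz_T ^^ j) m \<in> {1, 2}" ..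
  moreover have "(collatz_T ^^ Suc j) m = 1" if "(collatz_T ^^ j) m = 2"
    using that by (simp add: collatz_T_def)
  ultimately show "\<exists>j. (collatz_T ^^ j) m = 1" by blast
qed auto


section \<open>The initial configuration\<close>

lemma length_m8_word: "length (m8_word x k) = 2 * Suc k"
  by (induction k) (auto simp: m8_word_def)

lemma nth_m8_word:
  assumes "i \<le> k"
  shows "m8_word x k ! (2 * i) = S1" "m8_word x k ! (2 * i + 1) = digit_symbol (x i)"
proof -
  have "m8_word x k ! (2 * i) = S1 \<and> m8_word x k ! (2 * i + 1) = digit_symbol (x i)"
    using assms
  proof (induction k)
    case 0
    then show ?case by (simp add: m8_word_def)
  next
    case (Suc k)
    have "m8_word x (Suc k) = m8_word x k @ [S1, digit_symbol (x (Suc k))]"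
      by (simp add: m8_word_def)
    then show ?case
      using Suc length_m8_word[of x k] by (cases "i = Suc k") (auto simp: nth_append)
  qed
  then show "m8_word x k ! (2 * i) = S1" "m8_word x k ! (2 * i + 1) = digit_symbol (x i)"
    by auto
qed

lemma word_tape_m8_word:
  assumes "i \<le> k"
  shows "word_tape S0 (m8_word x k) (2 * int i) = S1"
    "word_tape S0 (m8_word x k) (2 * int i + 1) = digit_symbol (x i)"
proof -
  have "nat (2 * int i) = 2 * i" "nat (2 * int i + 1) = 2 * i + 1" by auto
  then show "word_tape S0 (m8_word x k) (2 * int i) = S1"
    "word_tape S0 (m8_word x k) (2 * int i + 1) = digit_symbol (x i)"
    using assms nth_m8_word[OF assms, of x] by (auto simp: word_tape_def length_m8_word)
qed

text \<open>The number is read off from the top digit downwards. Its value at a lower position is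
  positive because it contains the top digit \<open>x k = 1\<close>, as the encoding of a pair requires.\<close>

lemma encodes_word_tape:
  assumes "\<forall>i\<le>k. x i \<in> {0, 1}" "x k = 1" "i \<le> k"
  shows "encodes (word_tape S0 (m8_word x k)) (2 * int i) (\<Sum>j=i..k. x j * 2 ^ (j - i))"
  using assms(3)
proof (induction rule: inc_induct)
  case base
  have "encodes (word_tape S0 (m8_word x k)) (2 * int k) 1"
  proof (rule encodes.digit)
    show "word_tape S0 (m8_word x k) (2 * int k) = S1"
      "word_tape S0 (m8_word x k) (2 * int k + 1) = digit_symbol (1 mod 2)"
      using word_tape_m8_word[of k k x] assms(2) by auto
    show "encodes (word_tape S0 (m8_word x k)) (2 * int k + 2) (1 div 2)"
      by (auto intro!: encodes.zero simp: word_tape_def length_m8_word)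
  qed simp
  then show ?case by (simp add: assms(2))
next
  case (step i)
  let ?V = "\<lambda>i. \<Sum>j=i..k. x j * 2 ^ (j - i)"
  have "?V i = x i + (\<Sum>j=Suc i..k. x j * 2 ^ (j - i))"
    using step.hyps by (simp add: sum.atLeast_Suc_atMost)
  also have "(\<Sum>j=Suc i..k. x j * 2 ^ (j - i)) = 2 * ?V (Suc i)"
    unfolding sum_distrib_left
    by (intro sum.cong) (auto simp: Suc_diff_le simp flip: power_Suc)
  finally have V: "?V i = x i + 2 * ?V (Suc i)" .
  have "x i = 0 \<or> x i = 1" using assms(1) step.hyps by auto
  then have V': "?V i mod 2 = x i" "?V i div 2 = ?V (Suc i)" unfolding V by auto
  show ?case
  proof (rule encodes.digit)
    show "word_tape S0 (m8_word x k) (2 * int i) = S1"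
      "word_tape S0 (m8_word x k) (2 * int i + 1) = digit_symbol (?V i mod 2)"
      using word_tape_m8_word[of i k x] step.hyps unfolding V' by auto
    show "encodes (word_tape S0 (m8_word x k)) (2 * int i + 2) (?V i div 2)"
      using step.IH unfolding V' by (simp add: algebra_simps)
    have "x k * 2 ^ (k - i) \<le> ?V i" using step.hyps by (intro member_le_sum) auto
    then show "?V i > 0" using assms(2) by (auto intro: less_le_trans[rotated])
  qed
qed

lemma ready_m8_initial:
  assumes "\<forall>i\<le>k. x i \<in> {0, 1}" "x k = 1"
  shows "ready (\<Sum>i=0..k. x i * 2 ^ i) (m8_initial x k)"
  using encodes_word_tape[OF assms, of 0]
  by (auto simp: ready_def m8_initial_def word_tape_def[abs_def])

lemma binary_digits_exist:
  fixes n :: nat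
  assumes "n > 0"
  shows "\<exists>k x. (\<forall>i\<le>k. x i \<in> {0, 1}) \<and> x k = 1 \<and> n = (\<Sum>i=0..k. x i * 2 ^ i)"
  using assms
proof (induction n rule: less_induct)
  case (less n)
  show ?case
  proof (cases "n = 1")
    case True
    then show ?thesis by (intro exI[of _ 0] exI[of _ "\<lambda>_. 1"]) auto
  next
    case False
    then obtain k x where kx: "\<forall>i\<le>k. x i \<in> {0, 1}" "x k = 1"
      and half: "n div 2 = (\<Sum>i=0..k. x i * 2 ^ i)"
      using less.IH[of "n div 2"] less.prems by auto
    define y where "y i = (case i of 0 \<Rightarrow> n mod 2 | Suc j \<Rightarrow> x j)" for i
    have "\<forall>i\<le>Suc k. y i \<in> {0, 1}" using kx(1) by (auto simp: y_def split: nat.split)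
    moreover have "y (Suc k) = 1" by (simp add: y_def kx(2))
    moreover have "n = (\<Sum>i=0..Suc k. y i * 2 ^ i)"
    proof -
      have "(\<Sum>i=0..Suc k. y i * 2 ^ i) = y 0 + (\<Sum>i=0..k. y (Suc i) * 2 ^ Suc i)"
        by (subst sum.atLeast0_atMost_Suc_shift) simp
      also have "\<dots> = n mod 2 + 2 * (n div 2)"
        by (simp add: y_def half sum_distrib_left mult_ac)
      finally show ?thesis by simp
    qed
    ultimately show ?thesis by blast
  qed
qed

theorem theorem5p4:
  shows "collatz_conjecture \<longleftrightarrow>
    (\<forall>(n::nat) (k::nat) (x::nat \<Rightarrow> nat).
       n > 0 \<and> (\<forall>i\<le>k. x i \<in> {0, 1}) \<and> x k = 1 \<and> n = (\<Sum>i=0..k. x i * 2 ^ i)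
       \<longrightarrow> tm_halts M8 QZ (m8_initial x k))"
proof -
  let ?digits = "\<lambda>(n::nat) k x. n > 0 \<and> (\<forall>i\<le>k. x i \<in> {0, 1}) \<and> x k = 1 \<and> n = (\<Sum>i=0..k. x i * 2 ^ i)"
  have halts: "tm_halts M8 QZ (m8_initial x k) \<longleftrightarrow> (\<exists>j. (collatz_T ^^ j) n = 1)"
    if "?digits n k x" for n k x
  proof -
    have "ready n (m8_initial x k)" using ready_m8_initial[of k x] that by simp
    then show ?thesis using halts_iff_orbit_contains_1 that by simp
  qed
  have digits: "\<exists>k x. ?digits n k x" if "n > 0" for n :: nat
    using binary_digits_exist[OF that] that by simp
  show ?thesis
  proof
    assume "collatz_conjecture"
    then have "\<exists>j. (collatz_T ^^ j) n = 1" if "n > 0" for n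
      using that by (simp only: collatz_conjecture_def orbit_meets_cycle_iff_contains_1)
    then show "\<forall>n k x. ?digits n k x \<longrightarrow> tm_halts M8 QZ (m8_initial x k)"
      using halts by simp
  next
    assume all_halt: "\<forall>n k x. ?digits n k x \<longrightarrow> tm_halts M8 QZ (m8_initial x k)"
    have "\<exists>j. (collatz_T ^^ j) n = 1" if pos: "n > 0" for n
    proof -
      obtain k x where "?digits n k x" using digits[OF pos] by (elim exE)
      then show ?thesis using halts[of n k x] all_halt by blast
    qed
    then show "collatz_conjecture"
      unfolding collatz_conjecture_def orbit_meets_cycle_iff_contains_1 by blast
  qed
qed

end
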